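(* Let $f,g$ be analytic in the unit disk $\mathbb{D}$ with $f(0)=1$ and $g'(0)\neq 0$, and let $n\in\mathbb{N}=\{1,2,\ldots\}$. Then the normalized higher-order Volterra-type operator $\widetilde{T}_{g,n}$ admits the integral representation $$\widetilde{T}_{g,n}[f](z)=\frac{n}{g'(0)\,z^{n-1}}\int_0^z (z-t)^{n-1}f(t)g'(t)\,dt,\quad z\in\mathbb{D}.$$ In particular, $\widetilde{T}_{g,n}[f](0)=0$ and $(\widetilde{T}_{g,n}[f])'(0)=1$.
   Context: $\mathbb{D}=\{z\in\mathbb{C}:|z|<1\}$. For $f,g$ analytic in $\mathbb{D}$ and $h=fg'$, the $n$-th order Volterra-type integral operator, $n\in\mathbb{N}$, is $$T_{g,n}[f](z)=\int_0^z\int_0^{t_1}\cdots\int_0^{t_{n-1}}h(t_n)\,dt_n\cdots dt_1,\quad z\in\mathbb{D},$$ where the integrals are taken along the radial segment: $t_j=u_jz$ with $0\le u_n\le\cdots\le u_1\le 1$. For $f(0)=1$ and $g'(0)\ne0$, the normalized higher-order Volterra-type operator is $$\widetilde T_{g,n}[f](z)=\frac{n!}{g'(0)}\,\frac{T_{g,n}[f](z)}{z^{n-1}},$$ and values at $z=0$ are understood by removing the removable singularity. *)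

theory Defs
  imports "HOL-Complex_Analysis.Complex_Analysis"
begin

definition radial_primitive :: "(complex \<Rightarrow> complex) \<Rightarrow> complex \<Rightarrow> complex" where
  "radial_primitive h z = contour_integral (linepath 0 z) h"

(* The innermost integral of h(t_n) over [0, t_{n-1}] is radial_primitive h at t_{n-1}, and so on
   outwards, so the n-fold iterated integral is the n-th iterate of radial_primitive. All the
   variables t_j then lie on the segment from 0 to z. *)
definition volterra :: "(complex \<Rightarrow> complex) \<Rightarrow> nat \<Rightarrow> (complex \<Rightarrow> complex) \<Rightarrow> complex \<Rightarrow> complex" where
  "volterra g n f = (radial_primitive ^^ n) (\<lambda>t. f t * deriv g t)"

(* Value at the origin by removal of the singularity there. If F has no limit at 0,
   the value at 0 is unspecified. *)
definition fill_origin :: "(complex \<Rightarrow> complex) \<Rightarrow> complex \<Rightarrow> complex" where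
  "fill_origin F z = (if z = 0 then Lim (at 0) F else F z)"

definition normalized_volterra ::
  "(complex \<Rightarrow> complex) \<Rightarrow> nat \<Rightarrow> (complex \<Rightarrow> complex) \<Rightarrow> complex \<Rightarrow> complex" where
  "normalized_volterra g n f =
     fill_origin (\<lambda>z. fact n / deriv g 0 * (volterra g n f z / z ^ (n - 1)))"

end

theory Submission
  imports Defs
begin

text \<open>
  Write \<open>h = f g'\<close>. Iterating the operation "primitive vanishing at the origin" is the same as
  integrating once against the kernel \<open>(z - t)^m / m!\<close> (Cauchy's formula for repeated integration):
  each integration by parts lowers the power of \<open>z - t\<close> by one and replaces the integrand by its
  primitive, and the boundary terms vanish because the kernel is zero at \<open>t = z\<close> and the primitive
  is zero at \<open>t = 0\<close>. This is \<open>iterated_radial_primitive\<close>; it gives the integral representation away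
  from the origin. At the origin both sides are limits, and these depend only on
  values at nearby nonzero points, where the representation has already been established.

  For the behaviour at the origin, replacing \<open>h(t)\<close> by \<open>h(0)\<close> in the kernel integral gives exactly
  \<open>h(0) z^(m+1) / (m+1)\<close>, and continuity makes the error \<open>o(z^(m+1))\<close>
  (\<open>kernel_integral_asymptotics\<close>). With \<open>m = n - 1\<close> and \<open>h(0) = g'(0)\<close> the normalizing factor
  turns this into \<open>z + o(z)\<close>, which yields the value \<open>0\<close> and the derivative \<open>1\<close> simultaneously.
\<close>

lemma closed_segment_from_0_subset_ball:
  fixes z :: complex
  assumes "z \<in> ball 0 r"
  shows "closed_segment 0 z \<subseteq> ball 0 r"
proof (rule closed_segment_subset)
  have "0 < r" using assms norm_ge_zero[of z] by (simp del: norm_ge_zero)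
  then show "0 \<in> ball (0::complex) r" by simp
qed (use assms in auto)

lemma radial_primitive_0 [simp]: "radial_primitive h 0 = 0"
  by (simp add: radial_primitive_def)

lemma radial_primitive_has_field_derivative:
  assumes h: "h holomorphic_on ball 0 r" and z: "z \<in> ball 0 r"
  shows "(radial_primitive h has_field_derivative h z) (at z)"
proof -
  obtain G where G: "\<And>w. w \<in> ball 0 r \<Longrightarrow> (G has_field_derivative h w) (at w)"
    using holomorphic_convex_primitive'[OF convex_ball open_ball h] by (auto simp: at_within_open[OF _ open_ball])
  have eq: "radial_primitive h w = G w - G 0" if "w \<in> ball 0 r" for w
  proof -
    have "(h has_contour_integral (G (pathfinish (linepath 0 w)) - G (pathstart (linepath 0 w))))
            (linepath 0 w)"
      using closed_segment_from_0_subset_ball[OF that]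
      by (intro contour_integral_primitive[OF has_field_derivative_at_within[OF G]]) auto
    then show ?thesis
      by (simp add: radial_primitive_def contour_integral_unique)
  qed
  have "((\<lambda>w. G w - G 0) has_field_derivative h z) (at z)"
    using G[OF z] by (auto intro!: derivative_eq_intros)
  then show ?thesis
    by (rule has_field_derivative_transform_within_open[OF _ open_ball z]) (simp add: eq)
qed

lemma radial_primitive_holomorphic:
  assumes "h holomorphic_on ball 0 r"
  shows "radial_primitive h holomorphic_on ball 0 r"
  using radial_primitive_has_field_derivative[OF assms]
  unfolding holomorphic_on_open[OF open_ball] by blast

lemma kernel_contour_integrable:
  assumes "h holomorphic_on ball 0 r" "z \<in> ball 0 r"
  shows "(\<lambda>t. (z - t) ^ m * h t) contour_integrable_on linepath 0 z"
proof (rule contour_integrable_continuous_linepath)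
  have "h holomorphic_on closed_segment 0 z"
    using assms closed_segment_from_0_subset_ball by (meson holomorphic_on_subset)
  then show "continuous_on (closed_segment 0 z) (\<lambda>t. (z - t) ^ m * h t)"
    by (intro continuous_intros holomorphic_on_imp_continuous_on)
qed

text \<open>
  The product of \<open>(z - t)^(m+1)\<close> and the radial primitive of \<open>h\<close> vanishes at both ends of the
  segment, so its derivative integrates to zero there.
\<close>
lemma kernel_integration_by_parts:
  assumes h: "h holomorphic_on ball 0 r" and z: "z \<in> ball 0 r"
  shows "contour_integral (linepath 0 z) (\<lambda>t. (z - t) ^ Suc m * h t) =
         of_nat (Suc m) *
           contour_integral (linepath 0 z) (\<lambda>t. (z - t) ^ m * radial_primitive h t)"
proof -
  let ?H = "radial_primitive h"
  define D where "D t = (z - t) ^ Suc m * h t - of_nat (Suc m) * ((z - t) ^ m * ?H t)" for t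
  have deriv: "((\<lambda>t. (z - t) ^ Suc m * ?H t) has_field_derivative D t) (at t within ball 0 r)"
    if "t \<in> ball 0 r" for t
  proof -
    have "((\<lambda>t. (z - t) ^ Suc m) has_field_derivative - (of_nat (Suc m) * (z - t) ^ m))
            (at t within ball 0 r)"
      by (rule derivative_eq_intros refl | simp del: power_Suc of_nat_Suc)+
    from DERIV_mult[OF this
        has_field_derivative_at_within[OF radial_primitive_has_field_derivative[OF h that]]]
    show ?thesis
      by (simp add: D_def mult_ac del: power_Suc of_nat_Suc)
  qed
  have "(D has_contour_integral
          ((z - pathfinish (linepath 0 z)) ^ Suc m * ?H (pathfinish (linepath 0 z))
           - (z - pathstart (linepath 0 z)) ^ Suc m * ?H (pathstart (linepath 0 z))))
         (linepath 0 z)"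
    using closed_segment_from_0_subset_ball[OF z]
    by (intro contour_integral_primitive[OF deriv]) auto
  then have "contour_integral (linepath 0 z) D = 0"
    by (simp add: contour_integral_unique)
  moreover have "contour_integral (linepath 0 z) D =
      contour_integral (linepath 0 z) (\<lambda>t. (z - t) ^ Suc m * h t) -
      of_nat (Suc m) * contour_integral (linepath 0 z) (\<lambda>t. (z - t) ^ m * ?H t)"
    unfolding D_def
    using kernel_contour_integrable[OF h z, of "Suc m"]
      kernel_contour_integrable[OF radial_primitive_holomorphic[OF h] z, of m]
    by (simp add: contour_integral_diff contour_integral_lmul contour_integrable_lmul
        del: power_Suc of_nat_Suc)
  ultimately show ?thesis by simp
qed

text \<open>
  Cauchy's formula for repeated integration. The induction peels off the innermost integral, hence
  it must range over all integrands: \<open>h\<close> is replaced by its primitive.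
\<close>
lemma iterated_radial_primitive:
  assumes "h holomorphic_on ball 0 r" and z: "z \<in> ball 0 r"
  shows "(radial_primitive ^^ Suc m) h z =
         contour_integral (linepath 0 z) (\<lambda>t. (z - t) ^ m * h t) / fact m"
  using assms(1)
proof (induction m arbitrary: h)
  case 0
  show ?case by (simp add: radial_primitive_def linepath_def)
next
  case (Suc m)
  have "(radial_primitive ^^ Suc (Suc m)) h z = (radial_primitive ^^ Suc m) (radial_primitive h) z"
    by (simp only: funpow_Suc_right[of "Suc m"] o_apply)
  also have "\<dots> = contour_integral (linepath 0 z) (\<lambda>t. (z - t) ^ m * radial_primitive h t) / fact m"
    by (rule Suc.IH[OF radial_primitive_holomorphic[OF Suc.prems]])
  also have "\<dots> = contour_integral (linepath 0 z) (\<lambda>t. (z - t) ^ Suc m * h t) / fact (Suc m)"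
    unfolding kernel_integration_by_parts[OF Suc.prems z]
    by (simp add: divide_simps del: of_nat_Suc power_Suc)
  finally show ?case .
qed

lemma contour_integral_kernel:
  fixes z :: complex
  shows "((\<lambda>t. (z - t) ^ m) has_contour_integral z ^ Suc m / of_nat (Suc m)) (linepath 0 z)"
proof -
  have "((\<lambda>t. - ((z - t) ^ Suc m) / of_nat (Suc m)) has_field_derivative (z - t) ^ m)
          (at t within UNIV)" for t
    by (rule derivative_eq_intros refl | simp del: of_nat_Suc power_Suc)+
  from contour_integral_primitive[of UNIV, OF this, of "linepath 0 z"]
  show ?thesis by simp
qed

text \<open>
  On the segment \<open>|z - t| \<le> |z|\<close>, so an oscillation of \<open>h\<close> of size \<open>e\<close> near the origin changes the
  kernel integral by at most \<open>e |z|^(m+1)\<close>.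
\<close>
lemma kernel_integral_asymptotics:
  assumes h: "h holomorphic_on ball 0 r" and r: "r > 0"
  shows "((\<lambda>z. contour_integral (linepath 0 z) (\<lambda>t. (z - t) ^ m * h t) / z ^ Suc m)
           \<longlongrightarrow> h 0 / of_nat (Suc m)) (at 0)"
proof (rule LIM_I)
  fix e :: real
  assume e: "e > 0"
  have "isCont h 0"
    using h r by (intro continuous_on_interior[of "ball 0 r"] holomorphic_on_imp_continuous_on) auto
  then obtain d where d: "d > 0" "\<And>t. norm t < d \<Longrightarrow> norm (h t - h 0) < e / 2"
    using e unfolding continuous_at_eps_delta dist_norm
    by (metis diff_zero half_gt_zero)
  show "\<exists>s>0. \<forall>z. z \<noteq> 0 \<and> norm (z - 0) < s \<longrightarrow>
          norm (contour_integral (linepath 0 z) (\<lambda>t. (z - t) ^ m * h t) / z ^ Suc m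
                - h 0 / of_nat (Suc m)) < e"
  proof (intro exI[of _ "min d r"] conjI allI impI)
    fix z :: complex
    assume "z \<noteq> 0 \<and> norm (z - 0) < min d r"
    then have z: "z \<noteq> 0" "norm z < d" "z \<in> ball 0 r" by auto
    let ?I = "contour_integral (linepath 0 z) (\<lambda>t. (z - t) ^ m * h t)"
    have "((\<lambda>t. (z - t) ^ m * h t - h 0 * (z - t) ^ m) has_contour_integral
            ?I - h 0 * (z ^ Suc m / of_nat (Suc m))) (linepath 0 z)"
      by (intro has_contour_integral_diff has_contour_integral_lmul contour_integral_kernel
          has_contour_integral_integral kernel_contour_integrable[OF h z(3)])
    then have "norm (?I - h 0 * (z ^ Suc m / of_nat (Suc m))) \<le> norm z ^ m * (e / 2) * norm (z - 0)"
    proof (rule has_contour_integral_bound_linepath)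
      fix t assume t: "t \<in> closed_segment 0 z"
      have "norm t \<le> norm z" "norm (z - t) \<le> norm z"
        using segment_bound[OF t] by (auto simp: norm_minus_commute)
      moreover from this have "norm (h t - h 0) \<le> e / 2"
        using d(2)[of t] z by simp
      ultimately have "norm (z - t) ^ m * norm (h t - h 0) \<le> norm z ^ m * (e / 2)"
        by (intro mult_mono power_mono) auto
      moreover have "(z - t) ^ m * h t - h 0 * (z - t) ^ m = (z - t) ^ m * (h t - h 0)"
        by (simp add: algebra_simps)
      ultimately show "norm ((z - t) ^ m * h t - h 0 * (z - t) ^ m) \<le> norm z ^ m * (e / 2)"
        by (simp only: norm_mult norm_power)
    qed (use e in auto)
    then have "norm (?I - h 0 * (z ^ Suc m / of_nat (Suc m))) \<le> e / 2 * norm (z ^ Suc m)"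
      by (simp add: norm_power norm_mult mult_ac)
    moreover have "?I / z ^ Suc m - h 0 / of_nat (Suc m) =
        (?I - h 0 * (z ^ Suc m / of_nat (Suc m))) / z ^ Suc m"
      using z by (simp add: diff_divide_distrib del: of_nat_Suc power_Suc)
    ultimately have "norm (?I / z ^ Suc m - h 0 / of_nat (Suc m)) \<le> e / 2"
      using z by (simp add: norm_divide pos_divide_le_eq del: of_nat_Suc power_Suc)
    then show "norm (?I / z ^ Suc m - h 0 / of_nat (Suc m)) < e"
      using e by linarith
  qed (use d r in auto)
qed

lemma fill_origin_cong:
  assumes "z \<in> S" "open S" "0 \<in> S" and eq: "\<And>w. w \<in> S \<Longrightarrow> w \<noteq> 0 \<Longrightarrow> F w = G w"
  shows "fill_origin F z = fill_origin G z"
proof -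
  have "eventually (\<lambda>w. F w = G w) (at 0)"
    using eventually_at_topological eq assms(2,3) by blast
  then have "Lim (at 0) F = Lim (at 0) G"
    unfolding t2_space_class.Lim_def by (simp add: tendsto_cong)
  then show ?thesis
    using assms by (simp add: fill_origin_def)
qed

text \<open>
  A limit of \<open>F(w) / w\<close> at the origin forces \<open>F(w)\<close> to tend to \<open>0\<close>, and then \<open>F(w) / w\<close> is the
  difference quotient of the extended function.
\<close>
lemma fill_origin_derivative:
  assumes lim: "((\<lambda>w. F w / w) \<longlongrightarrow> L) (at 0)"
  shows "fill_origin F 0 = 0"
    and "(fill_origin F has_field_derivative L) (at 0)"
proof -
  have nz: "eventually (\<lambda>w. w \<noteq> 0) (at (0::complex))"
    by (simp add: eventually_neq_at_within)
  have "((\<lambda>w. F w / w * w) \<longlongrightarrow> L * 0) (at 0)"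
    by (intro tendsto_intros lim)
  moreover have "eventually (\<lambda>w. F w / w * w = F w) (at 0)"
    by (rule eventually_mono[OF nz]) simp
  ultimately have "(F \<longlongrightarrow> 0) (at 0)"
    using Lim_transform_eventually by fastforce
  then show 0: "fill_origin F 0 = 0"
    by (simp add: fill_origin_def tendsto_Lim)
  have "((\<lambda>w. fill_origin F w / w) \<longlongrightarrow> L) (at 0)"
    by (rule Lim_transform_eventually[OF lim eventually_mono[OF nz]])
       (simp add: fill_origin_def)
  then show "(fill_origin F has_field_derivative L) (at 0)"
    by (simp add: has_field_derivative_iff 0)
qed

theorem proposition4p4:
  fixes f g :: "complex \<Rightarrow> complex" and n :: nat
  assumes "f analytic_on ball 0 1"
    and "g analytic_on ball 0 1"
    and "f 0 = 1"
    and "deriv g 0 \<noteq> 0"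
    and "n \<ge> 1"
  shows "(\<forall>z \<in> ball 0 1. normalized_volterra g n f z =
            fill_origin (\<lambda>w. of_nat n / (deriv g 0 * w ^ (n - 1)) *
              contour_integral (linepath 0 w) (\<lambda>t. (w - t) ^ (n - 1) * f t * deriv g t)) z)
       \<and> normalized_volterra g n f 0 = 0
       \<and> (normalized_volterra g n f has_field_derivative 1) (at 0)"
proof -
  obtain m where n: "n = Suc m"
    using assms(5) by (cases n) auto
  define h where "h = (\<lambda>t. f t * deriv g t)"
  define F where "F = (\<lambda>z. fact n / deriv g 0 * (volterra g n f z / z ^ (n - 1)))"
  define K where "K = (\<lambda>w. contour_integral (linepath 0 w) (\<lambda>t. (w - t) ^ m * h t))"
  have nv: "normalized_volterra g n f = fill_origin F"
    by (simp add: normalized_volterra_def F_def)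
  have h: "h holomorphic_on ball 0 1"
    using assms(1,2) unfolding h_def
    by (intro analytic_imp_holomorphic analytic_intros analytic_deriv)
  have F_eq: "F w = of_nat n / (deriv g 0 * w ^ m) * K w" if "w \<in> ball 0 1" for w
  proof -
    have "volterra g n f w = K w / fact m"
      using iterated_radial_primitive[OF h that, of m]
      unfolding volterra_def K_def h_def n .
    then show ?thesis
      by (simp add: F_def n field_simps)
  qed
  have "((\<lambda>w. of_nat n / deriv g 0 * (K w / w ^ Suc m))
          \<longlongrightarrow> of_nat n / deriv g 0 * (h 0 / of_nat (Suc m))) (at 0)"
    unfolding K_def by (intro tendsto_mult tendsto_const kernel_integral_asymptotics[OF h]) simp
  moreover have "of_nat n / deriv g 0 * (h 0 / of_nat (Suc m)) = 1"
    using assms(3,4) by (simp add: n h_def del: of_nat_Suc)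
  moreover have "eventually (\<lambda>w. of_nat n / deriv g 0 * (K w / w ^ Suc m) = F w / w) (at 0)"
    unfolding eventually_at_topological
    by (intro exI[of _ "ball 0 1"]) (auto simp: F_eq mult_ac)
  ultimately have lim: "((\<lambda>w. F w / w) \<longlongrightarrow> 1) (at 0)"
    using Lim_transform_eventually by fastforce
  have "normalized_volterra g n f z =
          fill_origin (\<lambda>w. of_nat n / (deriv g 0 * w ^ (n - 1)) *
            contour_integral (linepath 0 w) (\<lambda>t. (w - t) ^ (n - 1) * f t * deriv g t)) z"
    if "z \<in> ball 0 1" for z
    unfolding nv
    by (rule fill_origin_cong[OF that open_ball]) (simp_all add: F_eq K_def h_def n mult.assoc)
  then show ?thesis
    using fill_origin_derivative[OF lim] by (simp add: nv)
qed

end
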